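(* Let $\Omega$ be a finite set, let $H \le G := \mathrm{Sym}(\Omega)$ and let $\alpha,\beta\in\Omega$ be distinct. Let $\Gamma := \Gamma(H,\Omega,(\alpha,\beta))$ be the orbital graph of $H$ with base-pair $(\alpha,\beta)$. Then $\Gamma$ is futile if and only if it has a unique connected component $\Delta$ of size at least $2$ and moreover one of the following holds: (a) $\Delta$ is a complete digraph, or (b) $\Delta$ is a complete bipartite digraph.
   Context: Permutations act on the right: $\omega^h$ is the image of $\omega\in\Omega$ under $h$, and $\omega^H$ is the $H$-orbit of $\omega$. The orbital graph $\Gamma(H,\Omega,(\alpha,\beta))$ (for $\alpha\neq\beta$) is the digraph with vertex set $\Omega$ and arc set $\{(\alpha^h,\beta^h)\mid h\in H\}$. All digraphs have no multiple arcs and no loops; both $(\gamma,\delta)$ and $(\delta,\gamma)$ may be arcs. Connected components are those of the underlying undirected graph (ignoring arc directions), and the size of a component is its number of vertices. Let $P$ be an ordered orbit partition of $H$ (the partition of $\Omega$ into $H$-orbits, listed in some order). Let $G_P$ be the stabilizer of $P$ in $G=\mathrm{Sym}(\Omega)$, i.e. the group of all permutations of $\Omega$ that stabilize every $H$-orbit as a set (so $G_P$ acts as the full symmetric group on every orbit). The orbital graph $\Gamma$ is called futile if and only if $G_P$, in its natural action on $\Omega$, induces graph automorphisms on $\Gamma$ (i.e. every element of $G_P$ is a digraph automorphism of $\Gamma$). A digraph with vertex set $V$ is a complete digraph if its arc set is $\{(\omega_1,\omega_2)\mid \omega_1,\omega_2\in V,\ \omega_1\ne\omega_2\}$. A digraph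 with vertex set $V$ and arc set $A$ is a complete bipartite digraph if $V$ is the disjoint union of subsets $S$ and $E$ such that $A=\{(\omega_1,\omega_2)\mid\omega_1\in S,\ \omega_2\in E\}$ (all arcs go from $S$ to $E$). *)

theory Defs
  imports "HOL-Algebra.Group_Action" "Graph_Theory.Digraph_Isomorphism"
begin

text \<open>
  \<open>Sym(\<Omega>)\<close> is \<open>BijGroup \<Omega>\<close>, whose elements are extensional on \<open>\<Omega>\<close>. The image \<open>\<omega>\<^sup>h\<close>
  of a point under a permutation is \<open>h \<omega>\<close>. The product of \<open>BijGroup\<close> is composition of
  functions, i.e. the opposite of the product for a right action; the subgroups, orbits and
  stabilizers are the same sets for both.
\<close>

definition orbital_graph ::
  "('a \<Rightarrow> 'a) set \<Rightarrow> 'a set \<Rightarrow> 'a \<times> 'a \<Rightarrow> ('a, 'a \<times> 'a) pre_digraph" where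
  "orbital_graph H \<Omega> p =
     with_proj \<lparr> pverts = \<Omega>, parcs = {(h (fst p), h (snd p)) | h. h \<in> H} \<rparr>"

definition ordered_orbit_partition ::
  "('a \<Rightarrow> 'a) set \<Rightarrow> 'a set \<Rightarrow> 'a set list \<Rightarrow> bool" where
  "ordered_orbit_partition H \<Omega> P \<longleftrightarrow>
     distinct P \<and> set P = orbits (BijGroup \<Omega> \<lparr>carrier := H\<rparr>) \<Omega> (\<lambda>h. h)"

text \<open>A permutation acts on an ordered partition by mapping each cell to its image.\<close>

definition partition_stabilizer :: "'a set \<Rightarrow> 'a set list \<Rightarrow> ('a \<Rightarrow> 'a) set" where
  "partition_stabilizer \<Omega> P = stabilizer (BijGroup \<Omega>) (\<lambda>g. map (\<lambda>X. g ` X)) P"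

text \<open>
  The library's digraph isomorphisms consist of a vertex map and an arc map; a permutation of the
  vertices induces an automorphism if it is the vertex map of one.
\<close>

definition induces_automorphism :: "('a, 'b) pre_digraph \<Rightarrow> ('a \<Rightarrow> 'a) \<Rightarrow> bool" where
  "induces_automorphism D g \<longleftrightarrow>
     (\<exists>f. pre_digraph.digraph_isomorphism D f \<and> iso_verts f = g \<and> app_iso f D = D)"

definition futile :: "'a set \<Rightarrow> 'a set list \<Rightarrow> ('a, 'b) pre_digraph \<Rightarrow> bool" where
  "futile \<Omega> P D \<longleftrightarrow> (\<forall>g \<in> partition_stabilizer \<Omega> P. induces_automorphism D g)"

text \<open>
  \<^const>\<open>Digraph_Component.connected\<close> is connectedness of the underlying undirected graph (the
  symmetric closure), so a component is a subdigraph that is maximal with this property.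
\<close>

definition connected_component_of :: "('a, 'b) pre_digraph \<Rightarrow> ('a, 'b) pre_digraph \<Rightarrow> bool" where
  "connected_component_of D C \<longleftrightarrow> pre_digraph.max_subgraph D Digraph_Component.connected C"

definition is_complete_digraph :: "('a, 'b) pre_digraph \<Rightarrow> bool" where
  "is_complete_digraph D \<longleftrightarrow> nomulti_digraph D \<and>
     arcs_ends D = {(u, v). u \<in> verts D \<and> v \<in> verts D \<and> u \<noteq> v}"

definition is_complete_bipartite_digraph :: "('a, 'b) pre_digraph \<Rightarrow> bool" where
  "is_complete_bipartite_digraph D \<longleftrightarrow> nomulti_digraph D \<and>
     (\<exists>S E. verts D = S \<union> E \<and> S \<inter> E = {} \<and> arcs_ends D = S \<times> E)"

end

theory Submission
  imports Defs "HOL-Combinatorics.Transposition"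
begin

text \<open>
  Write \<open>A\<close> for the arc set of \<open>\<Gamma>\<close>, and \<open>X\<close> and \<open>Y\<close> for the orbits of \<open>\<alpha>\<close> and \<open>\<beta>\<close>. The tails of the arcs of \<open>\<Gamma>\<close> fill \<open>X\<close> and
  their heads fill \<open>Y\<close>, and every arc is a pair of distinct points. Both sides of the equivalence
  say that \<open>\<Gamma>\<close> has all arcs which these constraints permit:
  \<open>A = {(x, y). x \<in> X \<and> y \<in> Y \<and> x \<noteq> y}\<close>.

  For futility (\<open>futile_orbital_graph_iff\<close>): the stabilizer of the orbit partition maps this set to
  itself, and it is transitive on it because it contains all transpositions of two points in a common
  orbit (\<open>stabilizer_moves_pair\<close>). Since \<open>A\<close> is a nonempty subset, it is invariant only if it is the
  whole set.

  For the graph-theoretic side: in a finite loop-free digraph with an arc, every arc lies in some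
  component with at least two vertices, and such a component has no isolated vertices. Hence there is
  exactly one such component iff the subdigraph of all non-isolated vertices is connected, and then it
  is this subdigraph (\<open>unique_nontrivial_component_iff\<close>), here with vertex set \<open>X \<union> Y\<close>. Two orbits
  are equal or disjoint. If \<open>X = Y\<close>, having all permitted arcs means being complete; if \<open>X\<close> and \<open>Y\<close>
  are disjoint, it means being complete bipartite from \<open>X\<close> to \<open>Y\<close>
  (\<open>complete_or_bipartite_iff\<close>).
\<close>

section \<open>Components of size at least two\<close>

definition nonisolated_part :: "('a, 'b) pre_digraph \<Rightarrow> ('a, 'b) pre_digraph" where
  "nonisolated_part D =
     \<lparr> verts = tail D ` arcs D \<union> head D ` arcs D, arcs = arcs D, tail = tail D, head = head D \<rparr>"

lemma nonisolated_part_simps [simp]: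
  "verts (nonisolated_part D) = tail D ` arcs D \<union> head D ` arcs D"
  "arcs (nonisolated_part D) = arcs D"
  "tail (nonisolated_part D) = tail D"
  "head (nonisolated_part D) = head D"
  by (simp_all add: nonisolated_part_def)

lemma wf_nonisolated_part: "wf_digraph (nonisolated_part D)"
  by unfold_locales auto

lemma subgraph_nonisolated_part:
  assumes "wf_digraph D"
  shows "subgraph (nonisolated_part D) D"
  using assms wf_digraph.wellformed[OF assms] wf_nonisolated_part
  by (auto simp: subgraph_def compatible_def)

lemma connected_imp_nonisolated:
  assumes "Digraph_Component.connected D" and "u \<in> verts D" and "v \<in> verts D" and "u \<noteq> v"
  shows "v \<in> tail D ` arcs D \<union> head D ` arcs D"
proof -
  have "(u, v) \<in> rtrancl_on (verts D) (parcs (mk_symmetric D))"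
    using assms unfolding connected_def strongly_connected_def reachable_def by simp
  then show ?thesis
    using \<open>u \<noteq> v\<close> by cases (auto simp: parcs_mk_symmetric)
qed

text \<open>
  Isolated vertices of \<open>D\<close> can only form components of size one, so the non-isolated part is an upper
  bound for all larger connected subdigraphs.
\<close>
lemma component_le_nonisolated_part:
  assumes "subgraph C D" and "Digraph_Component.connected C" and "card (verts C) \<ge> 2"
  shows "subgraph C (nonisolated_part D)"
proof -
  have C: "verts C \<subseteq> verts D" "arcs C \<subseteq> arcs D" "tail D = tail C" "head D = head C" "wf_digraph C"
    using assms(1) by (auto simp: subgraph_def compatible_def)
  have "verts C \<subseteq> tail C ` arcs C \<union> head C ` arcs C"
  proof
    fix v assume v: "v \<in> verts C"
    have "\<not> verts C \<subseteq> {v}"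
      using assms(3) card_mono[of "{v}" "verts C"] by auto
    then show "v \<in> tail C ` arcs C \<union> head C ` arcs C"
      using connected_imp_nonisolated[OF assms(2) _ v] by blast
  qed
  then have "verts C \<subseteq> tail D ` arcs D \<union> head D ` arcs D"
    unfolding C(3,4) using C(2) by blast
  then show ?thesis
    using C wf_nonisolated_part[of D] assms(1) by (simp add: subgraph_def compatible_def)
qed

text \<open>
  Among the connected subdigraphs above \<open>C\<close>, one with the largest number of vertices and arcs is
  maximal.
\<close>
lemma connected_subgraph_extends_to_component:
  assumes "fin_digraph D" and "subgraph C D" and "Digraph_Component.connected C"
  obtains C' where "connected_component_of D C'" and "subgraph C C'"
proof -
  interpret fin_digraph D by fact
  let ?P = "\<lambda>X. subgraph C X \<and> subgraph X D \<and> Digraph_Component.connected X"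
  let ?size = "\<lambda>X. card (verts X) + card (arcs X)"
  have bound: "?size X < Suc (?size D)" if "?P X" for X
    using that card_mono[OF finite_verts, of "verts X"] card_mono[OF finite_arcs, of "arcs X"]
    by (auto simp: subgraph_def)
  have "?P C"
    using assms wf_digraph.subgraph_refl by (auto simp: subgraph_def)
  then obtain X where X: "?P X" and max: "\<And>Y. ?P Y \<Longrightarrow> ?size Y \<le> ?size X"
    using ex_has_greatest_nat[of ?P C ?size "Suc (?size D)"] bound by blast
  have "Y = X" if Y: "subgraph X Y" "subgraph Y D" "Digraph_Component.connected Y" for Y
  proof -
    have le: "?size Y \<le> ?size X"
      using max Y X subgraph_trans by blast
    have sub: "verts X \<subseteq> verts Y" "arcs X \<subseteq> arcs Y" and comp: "tail X = tail Y" "head X = head Y"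
      using Y(1) by (auto simp: subgraph_def compatible_def)
    have fin: "finite (verts Y)" "finite (arcs Y)"
      using fin_digraph_subgraph[OF Y(2)] fin_digraph.finite_verts fin_digraph.finite_arcs by auto
    have "card (verts X) = card (verts Y)" "card (arcs X) = card (arcs Y)"
      using le card_mono[OF fin(1) sub(1)] card_mono[OF fin(2) sub(2)] by linarith+
    then have "verts X = verts Y" "arcs X = arcs Y"
      using card_subset_eq sub fin by blast+
    then show "Y = X"
      using comp by simp
  qed
  then have "connected_component_of D X"
    using X unfolding connected_component_of_def max_subgraph_def by blast
  then show ?thesis
    using that X by blast
qed

lemma arc_in_component:
  assumes "fin_digraph D" and "a \<in> arcs D"
  obtains C where "connected_component_of D C" and "a \<in> arcs C"
proof -
  interpret fin_digraph D by fact
  \<comment> \<open>The arc with its two ends is a connected subdigraph; it is extended to a component.\<close>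
  define C where "C = \<lparr> verts = {tail D a, head D a}, arcs = {a}, tail = tail D, head = head D \<rparr>"
  have "wf_digraph C"
    unfolding C_def by unfold_locales auto
  then interpret S: pair_wf_digraph "mk_symmetric C"
    by (rule wf_digraph.wellformed_mk_symmetric)
  have sub: "subgraph C D"
    using \<open>wf_digraph C\<close> assms(2) wellformed wf_digraph_axioms
    by (auto simp: subgraph_def compatible_def C_def)
  have symm: "parcs (mk_symmetric C) = {(tail D a, head D a), (head D a, tail D a)}"
      "verts C = {tail D a, head D a}"
    by (auto simp: C_def parcs_mk_symmetric)
  have conn: "Digraph_Component.connected C"
    unfolding connected_def
  proof (rule strongly_connectedI)
    fix u v assume "u \<in> verts (with_proj (mk_symmetric C))" "v \<in> verts (with_proj (mk_symmetric C))"
    then show "u \<rightarrow>\<^sup>*\<^bsub>with_proj (mk_symmetric C)\<^esub> v"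
      using symm by (cases "u = v") auto
  qed (simp add: symm)
  obtain C' where "connected_component_of D C'" "subgraph C C'"
    using connected_subgraph_extends_to_component[OF assms(1) sub conn] .
  moreover then have "a \<in> arcs C'"
    by (auto simp: subgraph_def C_def)
  ultimately show ?thesis
    using that by blast
qed

text \<open>
  Loop-freeness makes every component that contains an arc large, so a unique large component contains
  all arcs and equals the upper bound given by the non-isolated part. Conversely, if this upper bound
  is itself connected, then it is the only maximal connected subdigraph of size at least two.
\<close>
lemma unique_nontrivial_component_iff:
  assumes "fin_digraph D" and "loopfree_digraph D" and "arcs D \<noteq> {}"
  shows "(connected_component_of D C \<and> card (verts C) \<ge> 2) \<and>
         (\<forall>C'. connected_component_of D C' \<and> card (verts C') \<ge> 2 \<longrightarrow> C' = C) \<longleftrightarrow>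
         C = nonisolated_part D \<and> Digraph_Component.connected C"
    (is "?unique \<longleftrightarrow> ?part")
proof -
  interpret fin_digraph D by fact
  interpret loopfree_digraph D by fact
  have large: "card (verts C') \<ge> 2" if "subgraph C' D" "a \<in> arcs C'" for C' a
  proof -
    interpret C': fin_digraph C'
      using that(1) by (rule fin_digraph_subgraph)
    have "tail C' a \<noteq> head C' a"
      using that no_loops by (auto simp: subgraph_def compatible_def)
    then have "card {tail C' a, head C' a} = 2"
      by simp
    moreover have "{tail C' a, head C' a} \<subseteq> verts C'"
      using that(2) by auto
    ultimately show ?thesis
      using card_mono[OF C'.finite_verts] by metis
  qed
  note comp_def = connected_component_of_def max_subgraph_def
  show ?thesis
  proof
    assume unique: ?unique
    have sub: "subgraph C D" and conn: "Digraph_Component.connected C"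
      using unique unfolding comp_def by blast+
    have "arcs D \<subseteq> arcs C"
    proof
      fix a assume "a \<in> arcs D"
      then obtain C' where C': "connected_component_of D C'" "a \<in> arcs C'"
        using arc_in_component[OF assms(1)] by blast
      moreover from this have "card (verts C') \<ge> 2"
        using large unfolding comp_def by blast
      ultimately have "C' = C"
        using unique by blast
      then show "a \<in> arcs C"
        using C'(2) by simp
    qed
    moreover have "subgraph C (nonisolated_part D)"
      using component_le_nonisolated_part[OF sub conn] unique by blast
    ultimately have "C = nonisolated_part D"
      using wf_digraph.wellformed[of C]
      by (intro pre_digraph.equality) (auto simp: subgraph_def compatible_def)
    then show ?part
      using conn by simp
  next
    assume part: ?part
    have sub: "subgraph C D"
      using part subgraph_nonisolated_part[OF wf_digraph_axioms] by simp
    have large_C: "card (verts C) \<ge> 2"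
      using large[OF sub] part assms(3) by auto
    have comp: "connected_component_of D C"
      unfolding comp_def
    proof (intro conjI allI impI notI)
      fix C' assume C': "C' \<noteq> C \<and> subgraph C C'" "subgraph C' D \<and> Digraph_Component.connected C'"
      have "card (verts C') \<ge> 2"
        using large[of C'] C' part assms(3) by (auto simp: subgraph_def)
      then have "subgraph C' C"
        using component_le_nonisolated_part C' part by blast
      then show False
        using C' by (auto simp: subgraph_def compatible_def)
    qed (use sub part in auto)
    have "C' = C" if "connected_component_of D C'" "card (verts C') \<ge> 2" for C'
    proof -
      have "subgraph C' C"
        using that component_le_nonisolated_part part by (auto simp: comp_def)
      then show ?thesis
        using that(1) sub part unfolding comp_def by metis
    qed
    then show ?unique
      using comp large_C by blast
  qed
qed

section \<open>The stabilizer of the orbit partition\<close>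

locale finite_permutation_group =
  fixes \<Omega> :: "'a set" and H :: "('a \<Rightarrow> 'a) set"
  assumes finite_points: "finite \<Omega>" and subgroup: "subgroup H (BijGroup \<Omega>)"
begin

sublocale group_action "BijGroup \<Omega>\<lparr>carrier := H\<rparr>" \<Omega> "\<lambda>h. h"
  using group.canonical_inj_is_hom[OF group_BijGroup subgroup]
  by (intro group_action.intro) (simp add: id_def)

abbreviation orb :: "'a \<Rightarrow> 'a set" where
  "orb \<equiv> orbit (BijGroup \<Omega>\<lparr>carrier := H\<rparr>) (\<lambda>h. h)"

lemma orb_eq: "orb x = {h x | h. h \<in> H}"
  by (simp add: orbit_def)

lemma H_subset: "H \<subseteq> Bij \<Omega>"
  using subgroup.subset[OF subgroup] by (simp add: BijGroup_def)

lemma H_closed: "\<lbrakk>h \<in> H; x \<in> \<Omega>\<rbrakk> \<Longrightarrow> h x \<in> \<Omega>"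
  and H_inj: "\<lbrakk>h \<in> H; x \<in> \<Omega>; y \<in> \<Omega>; h x = h y\<rbrakk> \<Longrightarrow> x = y"
  using subsetD[OF H_subset] by (auto simp: Bij_def bij_betw_def dest: inj_onD)

lemma orb_subset: "x \<in> \<Omega> \<Longrightarrow> orb x \<subseteq> \<Omega>"
  by (auto simp: orb_eq H_closed)

lemma orb_disjoint: "\<lbrakk>x \<in> \<Omega>; y \<in> \<Omega>\<rbrakk> \<Longrightarrow> orb x = orb y \<or> orb x \<inter> orb y = {}"
  by (rule disjoint_union) (auto simp: orbits_def)

lemma orb_eqI:
  assumes "x \<in> \<Omega>" and "y \<in> orb x"
  shows "orb y = orb x"
proof -
  have "y \<in> \<Omega>"
    using orb_subset[OF assms(1)] assms(2) by (rule subsetD)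
  then show ?thesis
    using orb_disjoint[of y x] orbit_refl[of y] assms by blast
qed

text \<open>
  Membership in the stabilizer can be checked point by point: on a finite orbit an injection into
  the orbit is onto.
\<close>
lemma mem_partition_stabilizer_iff:
  assumes "ordered_orbit_partition H \<Omega> P"
  shows "g \<in> partition_stabilizer \<Omega> P \<longleftrightarrow> g \<in> Bij \<Omega> \<and> (\<forall>x\<in>\<Omega>. g x \<in> orb x)"
proof -
  have P: "set P = orb ` \<Omega>"
    using assms by (auto simp: ordered_orbit_partition_def orbits_def)
  have "map ((`) g) P = P \<longleftrightarrow> (\<forall>X\<in>set P. g ` X = X)"
    using map_eq_conv[of "(`) g" P id] by simp
  then have "g \<in> partition_stabilizer \<Omega> P \<longleftrightarrow> g \<in> Bij \<Omega> \<and> (\<forall>x\<in>\<Omega>. g ` orb x = orb x)"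
    by (simp add: partition_stabilizer_def stabilizer_def BijGroup_def P)
  moreover have "g ` orb x = orb x"
    if g: "g \<in> Bij \<Omega>" "\<forall>x\<in>\<Omega>. g x \<in> orb x" and x: "x \<in> \<Omega>" for x
  proof (rule endo_inj_surj)
    show "finite (orb x)"
      using finite_subset[OF orb_subset[OF x] finite_points] .
    show "g ` orb x \<subseteq> orb x"
      using g(2) orb_subset[OF x] orb_eqI[OF x] by blast
    show "inj_on g (orb x)"
      using g(1) orb_subset[OF x] by (auto simp: Bij_def bij_betw_def intro: inj_on_subset)
  qed
  ultimately show ?thesis
    using orbit_refl by blast
qed

text \<open>
  The witness first swaps \<open>\<alpha>\<close> with \<open>x\<close>, then swaps the resulting image \<open>b\<close> of \<open>\<beta>\<close> with \<open>y\<close>. The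
  second swap leaves \<open>x\<close> in place, since \<open>\<alpha> \<noteq> \<beta>\<close> gives \<open>b \<noteq> x\<close>. Both swaps exchange points of one
  orbit, because the first one does not move \<open>\<beta>\<close> out of its orbit. The argument covers equal and
  distinct orbits alike.
\<close>
lemma stabilizer_moves_pair:
  assumes P: "ordered_orbit_partition H \<Omega> P"
    and "\<alpha> \<in> \<Omega>" "\<beta> \<in> \<Omega>" "\<alpha> \<noteq> \<beta>" and x: "x \<in> orb \<alpha>" and y: "y \<in> orb \<beta>" and "x \<noteq> y"
  obtains g where "g \<in> partition_stabilizer \<Omega> P" and "g \<alpha> = x" and "g \<beta> = y"
proof -
  define b where "b = transpose \<alpha> x \<beta>"
  define f where "f = transpose b y \<circ> transpose \<alpha> x"
  have \<Omega>: "x \<in> \<Omega>" "y \<in> \<Omega>"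
    using assms orb_subset by blast+
  have [simp]: "orb x = orb \<alpha>" "orb y = orb \<beta>"
    using orb_eqI assms by blast+
  have b: "b \<in> \<Omega>" "orb b = orb \<beta>" "b \<noteq> x"
    using assms \<Omega> by (auto simp: b_def transpose_def)
  have swap: "orb (transpose u v z) = orb z" if "orb u = orb v" for u v z
    using that by (cases "z = u"; cases "z = v") auto
  have orb_f: "orb (f z) = orb z" for z
    unfolding f_def comp_apply by (simp add: swap b(2))
  have \<Omega>_f: "f z \<in> \<Omega>" if "z \<in> \<Omega>" for z
    using that assms(2) \<Omega> b(1) unfolding f_def comp_apply
    by (auto simp: transpose_def split: if_splits)
  have "inj f"
    by (simp add: f_def inj_compose)
  then have "bij_betw f \<Omega> \<Omega>"
    using endo_inj_surj[OF finite_points, of f] \<Omega>_f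
    by (auto simp: bij_betw_def intro: inj_on_subset)
  then have "restrict f \<Omega> \<in> Bij \<Omega>"
    by (simp add: Bij_def)
  moreover have "\<forall>z\<in>\<Omega>. restrict f \<Omega> z \<in> orb z"
    using orb_f \<Omega>_f orbit_refl by (metis restrict_apply')
  ultimately have "restrict f \<Omega> \<in> partition_stabilizer \<Omega> P"
    by (simp add: mem_partition_stabilizer_iff[OF P])
  moreover have "f \<alpha> = x" "f \<beta> = y"
    using b(3) \<open>x \<noteq> y\<close> by (simp_all add: f_def b_def[symmetric])
  ultimately show ?thesis
    using that assms(2,3) by simp
qed

end

section \<open>Futility of an orbital graph\<close>

text \<open>
  When arcs are pairs, an automorphism must preserve the projections, so its vertex map forces the
  arc map.
\<close>
lemma induces_automorphism_with_proj_iff: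
  assumes "A \<subseteq> V \<times> V"
  shows "induces_automorphism (with_proj \<lparr> pverts = V, parcs = A \<rparr>) g \<longleftrightarrow>
         bij_betw g V V \<and> map_prod g g ` A = A"
proof -
  let ?D = "with_proj \<lparr> pverts = V, parcs = A \<rparr>"
  have wf: "wf_digraph ?D"
    using assms by unfold_locales auto
  show ?thesis
  proof
    assume "induces_automorphism ?D g"
    then obtain f where f: "pre_digraph.digraph_isomorphism ?D f" "iso_verts f = g" "app_iso f ?D = ?D"
      unfolding induces_automorphism_def by blast
    have "g ` V = V" "iso_arcs f ` A = A" "iso_tail f = fst" "iso_head f = snd"
      using f(2) arg_cong[OF f(3), of verts] arg_cong[OF f(3), of arcs]
        arg_cong[OF f(3), of tail] arg_cong[OF f(3), of head] by simp_all
    moreover from this have "iso_arcs f a = map_prod g g a" if "a \<in> A" for a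
      using f(1,2) that by (auto simp: pre_digraph.digraph_isomorphism_def prod_eq_iff)
    moreover have "inj_on g V"
      using f(1,2) by (simp add: pre_digraph.digraph_isomorphism_def)
    ultimately show "bij_betw g V V \<and> map_prod g g ` A = A"
      unfolding bij_betw_def by (metis image_cong)
  next
    assume g: "bij_betw g V V \<and> map_prod g g ` A = A"
    define f where
      "f = \<lparr> iso_verts = g, iso_arcs = map_prod g g, iso_head = snd, iso_tail = fst \<rparr>"
    have "inj_on (map_prod g g) A"
      using g assms map_prod_inj_on[of g V g V] by (auto simp: bij_betw_def intro: inj_on_subset)
    then have "pre_digraph.digraph_isomorphism ?D f"
      using g wf by (simp add: pre_digraph.digraph_isomorphism_def f_def bij_betw_def)
    moreover have "app_iso f ?D = ?D"
      using g by (simp add: app_iso_def f_def bij_betw_def with_proj_def)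
    ultimately show "induces_automorphism ?D g"
      unfolding induces_automorphism_def f_def by fastforce
  qed
qed

context finite_permutation_group
begin

lemma arcs_orbital_graph:
  "arcs (orbital_graph H \<Omega> (\<alpha>, \<beta>)) = {(h \<alpha>, h \<beta>) | h. h \<in> H}"
  by (simp add: orbital_graph_def)

lemma orbital_graph_digraph:
  assumes "\<alpha> \<in> \<Omega>" "\<beta> \<in> \<Omega>" "\<alpha> \<noteq> \<beta>"
  shows "digraph (orbital_graph H \<Omega> (\<alpha>, \<beta>))"
proof -
  let ?A = "{(h \<alpha>, h \<beta>) | h. h \<in> H}"
  have h: "h \<alpha> \<in> \<Omega>" "h \<beta> \<in> \<Omega>" "h \<alpha> \<noteq> h \<beta>" if "h \<in> H" for h
    using that assms H_closed H_inj by blast+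
  then have "?A \<subseteq> \<Omega> \<times> \<Omega>"
    by auto
  then have "finite ?A"
    using finite_points finite_subset by blast
  then show ?thesis
    using h finite_points
    by unfold_locales (auto simp: orbital_graph_def arc_to_ends_def)
qed

text \<open>
  The stabilizer is transitive on the pairs on the right-hand side, and \<open>(\<alpha>, \<beta>)\<close> is one of them. So
  the arc set is invariant only if it contains them all, and the set of all these pairs is visibly
  invariant.
\<close>
lemma futile_orbital_graph_iff:
  assumes P: "ordered_orbit_partition H \<Omega> P" and ab: "\<alpha> \<in> \<Omega>" "\<beta> \<in> \<Omega>" "\<alpha> \<noteq> \<beta>"
  shows "futile \<Omega> P (orbital_graph H \<Omega> (\<alpha>, \<beta>)) \<longleftrightarrow>
         arcs (orbital_graph H \<Omega> (\<alpha>, \<beta>)) = {(x, y). x \<in> orb \<alpha> \<and> y \<in> orb \<beta> \<and> x \<noteq> y}"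
proof -
  let ?A = "{(h \<alpha>, h \<beta>) | h. h \<in> H}"
  let ?B = "{(x, y). x \<in> orb \<alpha> \<and> y \<in> orb \<beta> \<and> x \<noteq> y}"
  have AB: "?A \<subseteq> ?B"
    using ab H_inj by (auto simp: orb_eq)
  have B\<Omega>: "?B \<subseteq> \<Omega> \<times> \<Omega>"
    using orb_subset ab by blast
  have "(\<lambda>x\<in>\<Omega>. x) \<in> H"
    using subgroup.one_closed[OF subgroup] by (simp add: BijGroup_def)
  then have base: "(\<alpha>, \<beta>) \<in> ?A"
    using ab by (intro CollectI exI[of _ "\<lambda>x\<in>\<Omega>. x"]) simp
  have futile: "futile \<Omega> P (orbital_graph H \<Omega> (\<alpha>, \<beta>)) \<longleftrightarrow>
      (\<forall>g\<in>partition_stabilizer \<Omega> P. map_prod g g ` ?A = ?A)"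
    using AB B\<Omega> mem_partition_stabilizer_iff[OF P]
    by (auto simp: futile_def orbital_graph_def Bij_def induces_automorphism_with_proj_iff)
  have eq: "?A = ?B" if inv: "\<forall>g\<in>partition_stabilizer \<Omega> P. map_prod g g ` ?A = ?A"
  proof
    show "?B \<subseteq> ?A"
    proof clarify
      fix x y assume "x \<in> orb \<alpha>" "y \<in> orb \<beta>" "x \<noteq> y"
      then obtain g where g: "g \<in> partition_stabilizer \<Omega> P" "g \<alpha> = x" "g \<beta> = y"
        using stabilizer_moves_pair[OF P ab] by blast
      have "map_prod g g (\<alpha>, \<beta>) \<in> ?A"
        using inv g(1) base by blast
      then show "\<exists>h. (x, y) = (h \<alpha>, h \<beta>) \<and> h \<in> H"
        using g by auto
    qed
  qed (rule AB)
  have inv_B: "map_prod g g ` ?B = ?B" if "g \<in> partition_stabilizer \<Omega> P" for g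
  proof (rule endo_inj_surj)
    have g: "g \<in> Bij \<Omega>" "\<And>x. x \<in> \<Omega> \<Longrightarrow> g x \<in> orb x"
      using that mem_partition_stabilizer_iff[OF P] by auto
    then have inj: "inj_on g \<Omega>"
      by (simp add: Bij_def bij_betw_def)
    have orb: "g x \<in> orb z" if "z \<in> \<Omega>" "x \<in> orb z" for x z
      using g(2)[of x] orb_eqI[OF that] orb_subset that by blast
    show "finite ?B"
      using finite_subset[OF B\<Omega>] finite_points by blast
    show "map_prod g g ` ?B \<subseteq> ?B"
    proof (rule image_subsetI)
      fix p assume "p \<in> ?B"
      then obtain x y where p: "p = (x, y)" and xy: "x \<in> orb \<alpha>" "y \<in> orb \<beta>" "x \<noteq> y"
        by blast
      then have "x \<in> \<Omega>" "y \<in> \<Omega>"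
        using orb_subset ab by blast+
      then have "g x \<noteq> g y"
        using inj_onD[OF inj] xy(3) by blast
      then show "map_prod g g p \<in> ?B"
        using orb ab xy p by simp
    qed
    show "inj_on (map_prod g g) ?B"
      using inj_on_subset[OF map_prod_inj_on[OF inj inj] B\<Omega>] .
  qed
  have "(\<forall>g\<in>partition_stabilizer \<Omega> P. map_prod g g ` ?A = ?A) \<longleftrightarrow> ?A = ?B"
  proof
    assume "?A = ?B"
    show "\<forall>g\<in>partition_stabilizer \<Omega> P. map_prod g g ` ?A = ?A"
      unfolding \<open>?A = ?B\<close> using inv_B by (rule ballI)
  qed (rule eq)
  then show ?thesis
    unfolding futile arcs_orbital_graph .
qed

lemma orbital_graph_tails_heads:
  "fst ` arcs (orbital_graph H \<Omega> (\<alpha>, \<beta>)) = orb \<alpha>"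
  "snd ` arcs (orbital_graph H \<Omega> (\<alpha>, \<beta>)) = orb \<beta>"
  by (auto simp: orbital_graph_def orb_eq image_iff)

text \<open>
  A complete \<open>\<Delta>\<close> contains the reversed arc \<open>(\<beta>, \<alpha>)\<close>, which forces the two orbits to coincide. A
  complete bipartite \<open>\<Delta>\<close> has the two orbits as its sides, since the sides are the projections of a
  nonempty product. Conversely, if all pairs of distinct points are arcs, then two vertices on the
  same side are joined through \<open>\<alpha>\<close> or \<open>\<beta>\<close>, which gives connectedness.
\<close>
lemma complete_or_bipartite_iff:
  assumes ab: "\<alpha> \<in> \<Omega>" "\<beta> \<in> \<Omega>" "\<alpha> \<noteq> \<beta>"
  defines "\<Gamma> \<equiv> orbital_graph H \<Omega> (\<alpha>, \<beta>)"
  shows "Digraph_Component.connected (nonisolated_part \<Gamma>) \<and>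
         (is_complete_digraph (nonisolated_part \<Gamma>) \<or> is_complete_bipartite_digraph (nonisolated_part \<Gamma>))
         \<longleftrightarrow> arcs \<Gamma> = {(x, y). x \<in> orb \<alpha> \<and> y \<in> orb \<beta> \<and> x \<noteq> y}"
    (is "?conn \<and> (?complete \<or> ?bipartite) \<longleftrightarrow> _ = ?B")
proof -
  let ?\<Delta> = "nonisolated_part \<Gamma>"
  interpret digraph \<Gamma>
    unfolding \<Gamma>_def using orbital_graph_digraph[OF ab] .
  have [simp]: "tail \<Gamma> = fst" "head \<Gamma> = snd"
    by (simp_all add: \<Gamma>_def orbital_graph_def)
  have proj: "fst ` arcs \<Gamma> = orb \<alpha>" "snd ` arcs \<Gamma> = orb \<beta>"
    by (simp_all add: \<Gamma>_def orbital_graph_tails_heads)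
  have ends: "arcs_ends ?\<Delta> = arcs \<Gamma>"
    by (simp add: arcs_ends_def arc_to_ends_def)
  have verts: "verts ?\<Delta> = orb \<alpha> \<union> orb \<beta>"
    by (simp add: proj)
  have nomulti: "nomulti_digraph ?\<Delta>"
    using wf_nonisolated_part
    by (auto simp: nomulti_digraph_def nomulti_digraph_axioms_def arc_to_ends_def prod_eq_iff)
  have mem: "\<alpha> \<in> orb \<alpha>" "\<beta> \<in> orb \<beta>"
    using ab orbit_refl by auto
  show ?thesis
  proof
    assume "?conn \<and> (?complete \<or> ?bipartite)"
    then consider ?complete | ?bipartite
      by blast
    then show "arcs \<Gamma> = ?B"
    proof cases
      case 1
      then have arcs: "arcs \<Gamma> = {(u, v). u \<in> orb \<alpha> \<union> orb \<beta> \<and> v \<in> orb \<alpha> \<union> orb \<beta> \<and> u \<noteq> v}"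
        by (simp add: is_complete_digraph_def ends verts del: nonisolated_part_simps)
      then have "(\<beta>, \<alpha>) \<in> arcs \<Gamma>"
        using mem ab by auto
      then have "\<beta> \<in> orb \<alpha>"
        unfolding proj(1)[symmetric] by force
      then have "orb \<beta> = orb \<alpha>"
        using orb_eqI ab by blast
      then show ?thesis
        using arcs by auto
    next
      case 2
      then obtain S E where SE: "S \<inter> E = {}" "arcs \<Gamma> = S \<times> E"
        by (auto simp: is_complete_bipartite_digraph_def ends)
      moreover have "S \<noteq> {}" "E \<noteq> {}"
        using SE(2) proj mem by auto
      ultimately have "S = orb \<alpha>" "E = orb \<beta>"
        using proj by auto
      then show ?thesis
        using SE by auto
    qed
  next
    assume arcs: "arcs \<Gamma> = ?B"
    interpret S: pair_wf_digraph "mk_symmetric ?\<Delta>"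
      using wf_nonisolated_part by (rule wf_digraph.wellformed_mk_symmetric)
    have adj: "u \<rightarrow>\<^sup>*\<^bsub>with_proj (mk_symmetric ?\<Delta>)\<^esub> v" "v \<rightarrow>\<^sup>*\<^bsub>with_proj (mk_symmetric ?\<Delta>)\<^esub> u"
      if "u \<in> orb \<alpha>" "v \<in> orb \<beta>" for u v
    proof -
      have refl: "u \<rightarrow>\<^sup>*\<^bsub>with_proj (mk_symmetric ?\<Delta>)\<^esub> u"
        using that verts by (intro S.reachable_refl) auto
      have "(u, v) \<in> arcs \<Gamma>" if "u \<noteq> v"
        using that arcs \<open>u \<in> orb \<alpha>\<close> \<open>v \<in> orb \<beta>\<close> by simp
      then have "(u, v) \<in> parcs (mk_symmetric ?\<Delta>) \<and> (v, u) \<in> parcs (mk_symmetric ?\<Delta>)" if "u \<noteq> v"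
        using that by (auto simp: parcs_mk_symmetric intro!: bexI[of _ "(u, v)"])
      then show "u \<rightarrow>\<^sup>*\<^bsub>with_proj (mk_symmetric ?\<Delta>)\<^esub> v" "v \<rightarrow>\<^sup>*\<^bsub>with_proj (mk_symmetric ?\<Delta>)\<^esub> u"
        using refl by (cases "u = v"; simp)+
    qed
    have conn: ?conn
      unfolding connected_def
    proof (rule strongly_connectedI)
      fix u v
      assume "u \<in> verts (with_proj (mk_symmetric ?\<Delta>))" "v \<in> verts (with_proj (mk_symmetric ?\<Delta>))"
      then have "u \<in> orb \<alpha> \<union> orb \<beta>" "v \<in> orb \<alpha> \<union> orb \<beta>"
        using verts by auto
      then show "u \<rightarrow>\<^sup>*\<^bsub>with_proj (mk_symmetric ?\<Delta>)\<^esub> v"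
        using adj mem S.reachable_trans by blast
    qed (use mem verts in auto)
    consider "orb \<alpha> = orb \<beta>" | "orb \<alpha> \<inter> orb \<beta> = {}"
      using orb_disjoint ab by blast
    then have "?complete \<or> ?bipartite"
    proof cases
      case 1
      then have ?complete
        using nomulti arcs
        by (simp add: is_complete_digraph_def ends verts del: nonisolated_part_simps)
      then show ?thesis ..
    next
      case 2
      then have "arcs_ends ?\<Delta> = orb \<alpha> \<times> orb \<beta>"
        using arcs ends by auto
      then have ?bipartite
        using nomulti 2 verts unfolding is_complete_bipartite_digraph_def by blast
      then show ?thesis ..
    qed
    with conn show "?conn \<and> (?complete \<or> ?bipartite)" ..
  qed
qed

end

theorem theorem3p2:
  fixes \<Omega> :: "'a set" and H :: "('a \<Rightarrow> 'a) set" and \<alpha> \<beta> :: 'a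
    and P :: "'a set list" and \<Gamma> :: "('a, 'a \<times> 'a) pre_digraph"
  assumes "finite \<Omega>"
    and "subgroup H (BijGroup \<Omega>)"
    and "\<alpha> \<in> \<Omega>" and "\<beta> \<in> \<Omega>" and "\<alpha> \<noteq> \<beta>"
    and "ordered_orbit_partition H \<Omega> P"
  defines "\<Gamma> \<equiv> orbital_graph H \<Omega> (\<alpha>, \<beta>)"
  shows "futile \<Omega> P \<Gamma> \<longleftrightarrow>
    (\<exists>\<Delta>. (connected_component_of \<Gamma> \<Delta> \<and> card (verts \<Delta>) \<ge> 2) \<and>
         (\<forall>\<Delta>'. connected_component_of \<Gamma> \<Delta>' \<and> card (verts \<Delta>') \<ge> 2 \<longrightarrow> \<Delta>' = \<Delta>) \<and>
         (is_complete_digraph \<Delta> \<or> is_complete_bipartite_digraph \<Delta>))"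
proof -
  interpret finite_permutation_group \<Omega> H
    using assms(1,2) by (rule finite_permutation_group.intro)
  interpret digraph \<Gamma>
    unfolding \<Gamma>_def using orbital_graph_digraph assms by blast
  have "arcs \<Gamma> \<noteq> {}"
    using orbital_graph_tails_heads(1)[of \<alpha> \<beta>] orbit_refl[OF \<open>\<alpha> \<in> \<Omega>\<close>] by (auto simp: \<Gamma>_def)
  note unique = unique_nontrivial_component_iff[OF fin_digraph_axioms loopfree_digraph_axioms this]
  have "(\<exists>\<Delta>. (connected_component_of \<Gamma> \<Delta> \<and> card (verts \<Delta>) \<ge> 2) \<and>
         (\<forall>\<Delta>'. connected_component_of \<Gamma> \<Delta>' \<and> card (verts \<Delta>') \<ge> 2 \<longrightarrow> \<Delta>' = \<Delta>) \<and>
         (is_complete_digraph \<Delta> \<or> is_complete_bipartite_digraph \<Delta>)) \<longleftrightarrow>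
    (\<exists>\<Delta>. (\<Delta> = nonisolated_part \<Gamma> \<and> Digraph_Component.connected \<Delta>) \<and>
         (is_complete_digraph \<Delta> \<or> is_complete_bipartite_digraph \<Delta>))"
    unfolding unique[symmetric] by (simp only: conj_assoc)
  also have "\<dots> \<longleftrightarrow> futile \<Omega> P \<Gamma>"
    using futile_orbital_graph_iff[OF assms(6,3,4,5)] complete_or_bipartite_iff[OF assms(3,4,5)]
    unfolding \<Gamma>_def by blast
  finally show ?thesis ..
qed

end
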